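(* Suppose that there are two targets $t_1,t_2$ and let $p_1=p_2=\frac12$. Then any deterministic (possibly adaptive) algorithm needs in the worst case at least $\frac{n}{2}-1$ queries to detect one of the two targets, even when the graph is an unweighted cycle with $n$ vertices.
   Context: Graphs $G=(V,E)$, $|V|=n$, are connected, simple, undirected, with positive edge weights $w$ (unweighted: all weights $1$); $d$ is the shortest-path distance, and $N(v)$ is the set of neighbors of $v$. For $u\in N(v)$, $N(v,u)=\{x\in V: d(v,x)=w(vu)+d(u,x)\}$. The unknown (distinct) targets $t_1,t_2\in V$ are placed by an adversary. A direction query at $v$ independently directs with probability $p_i$ to $t_i$, in which case it returns a neighbor $u\in N(v)$ with $t_i\in N(v,u)$ (possibly chosen adversarially if there are several), without disclosing $i$; if $v=t_i$ this is revealed by the query with probability $p_i$. To detect a target means to determine with certainty some vertex that is a target. *)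

theory Defs
  imports "Graph_Theory.Graph_Theory" "HOL-Probability.Probability"
begin

text \<open>
  Undirected graphs are represented by symmetric loop-free digraphs (\<open>pair_graph\<close>),
  weighted by a function on arcs; the distance is the library's shortest-path
  distance \<open>\<mu>\<close>.
\<close>

abbreviation graph_dist :: "'v pair_pre_digraph \<Rightarrow> ('v \<times> 'v) weight_fun \<Rightarrow> 'v \<Rightarrow> 'v \<Rightarrow> ereal" where
  "graph_dist G w \<equiv> wf_digraph.\<mu> (with_proj G) w"

definition nbrs :: "'v pair_pre_digraph \<Rightarrow> 'v \<Rightarrow> 'v set" where
  "nbrs G v = {u. (v, u) \<in> parcs G}"

text \<open>The set \<open>N(v,u)\<close>, meant for \<open>u \<in> nbrs G v\<close>.\<close>

definition via_nbr ::
  "'v pair_pre_digraph \<Rightarrow> ('v \<times> 'v) weight_fun \<Rightarrow> 'v \<Rightarrow> 'v \<Rightarrow> 'v set" where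
  "via_nbr G w v u =
    {x \<in> pverts G. graph_dist G w v x = ereal (w (v, u)) + graph_dist G w u x}"

definition cycle_graph :: "nat \<Rightarrow> nat pair_pre_digraph" where
  "cycle_graph n =
    \<lparr> pverts = {..<n},
      parcs = {(i, j). i < n \<and> j < n \<and> (j = Suc i mod n \<or> i = Suc j mod n)} \<rparr>"

lemma pair_graph_cycle_graph:
  assumes "n \<ge> 3"
  shows "pair_graph (cycle_graph n)"
proof
  show "finite (parcs (cycle_graph n))"
    by (rule finite_subset[of _ "{..<n} \<times> {..<n}"]) (auto simp: cycle_graph_def)
  show "fst e \<noteq> snd e" if "e \<in> parcs (cycle_graph n)" for e
    using that assms by (auto simp: cycle_graph_def mod_Suc split: if_splits)
qed (auto simp: cycle_graph_def symmetric_def intro!: symI)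

text \<open>
  A response does not disclose the index of the target it refers to. A history is the
  list of all queries made so far together with their responses, oldest first. A
  deterministic adaptive algorithm maps each history to the next vertex to query.
\<close>

datatype 'v response = Is_Target | Towards 'v

type_synonym 'v history = "('v \<times> 'v response) list"
type_synonym 'v algorithm = "'v history \<Rightarrow> 'v"

text \<open>
  A tie-breaking rule \<open>c\<close> is the adversary's choice among the correct neighbours:
  \<open>c h v t\<close> is the neighbour returned when \<open>v\<close> is queried after history \<open>h\<close> and the
  query directs to \<open>t \<noteq> v\<close>.
\<close>

type_synonym 'v tie_breaking = "'v history \<Rightarrow> 'v \<Rightarrow> 'v \<Rightarrow> 'v"

definition admissible ::
  "'v pair_pre_digraph \<Rightarrow> ('v \<times> 'v) weight_fun \<Rightarrow> 'v \<Rightarrow> 'v \<Rightarrow> 'v tie_breaking \<Rightarrow> bool" where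
  "admissible G w t1 t2 c \<longleftrightarrow>
     t1 \<in> pverts G \<and> t2 \<in> pverts G \<and> t1 \<noteq> t2 \<and>
     (\<forall>h. \<forall>v\<in>pverts G. \<forall>t\<in>{t1, t2}. v \<noteq> t \<longrightarrow>
        c h v t \<in> nbrs G v \<and> t \<in> via_nbr G w v (c h v t))"

text \<open>Here \<open>p\<close> is the probability \<open>p\<^sub>1\<close> of directing to \<open>t1\<close>, and \<open>p\<^sub>2 = 1 - p\<close>.\<close>

definition query_pmf ::
  "real \<Rightarrow> 'v \<Rightarrow> 'v \<Rightarrow> 'v tie_breaking \<Rightarrow> 'v history \<Rightarrow> 'v \<Rightarrow> 'v response pmf" where
  "query_pmf p t1 t2 c h v =
     map_pmf (\<lambda>b. let t = (if b then t1 else t2)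
                   in if v = t then Is_Target else Towards (c h v t))
       (bernoulli_pmf p)"

primrec history_pmf ::
  "real \<Rightarrow> 'v \<Rightarrow> 'v \<Rightarrow> 'v tie_breaking \<Rightarrow> 'v algorithm \<Rightarrow> nat \<Rightarrow> 'v history pmf" where
  "history_pmf p t1 t2 c A 0 = return_pmf []"
| "history_pmf p t1 t2 c A (Suc m) =
     bind_pmf (history_pmf p t1 t2 c A m)
       (\<lambda>h. map_pmf (\<lambda>r. h @ [(A h, r)]) (query_pmf p t1 t2 c h (A h)))"

text \<open>
  A target is detected by the history \<open>h\<close> if some vertex is a target for every choice
  of targets and tie-breaking under which \<open>h\<close> can occur.
\<close>

definition detected ::
  "'v pair_pre_digraph \<Rightarrow> ('v \<times> 'v) weight_fun \<Rightarrow> real \<Rightarrow> 'v algorithm \<Rightarrow> 'v history \<Rightarrow> bool" where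
  "detected G w p A h \<longleftrightarrow>
     (\<exists>x. \<forall>t1 t2 c. admissible G w t1 t2 c \<and> h \<in> set_pmf (history_pmf p t1 t2 c A (length h))
        \<longrightarrow> x \<in> {t1, t2})"

end

theory Submission
  imports Defs "HOL-Number_Theory.Cong"
begin

text \<open>
  On the cycle \<open>{0, \<dots>, n - 1}\<close> the adversary always directs the searcher to the clockwise
  neighbour. For every \<open>t\<close>, this answer is correct for one of the two nearly antipodal
  targets \<open>t\<close> and \<open>t + n div 2\<close>, unless one of them is queried itself. Each query therefore
  rules out at most two values of \<open>t\<close>, and every vertex belongs to the pairs of at most two
  values of \<open>t\<close>. If \<open>2 * m + 2 < n\<close>, then for every vertex \<open>x\<close> some pair avoiding \<open>x\<close> is
  still consistent after \<open>m\<close> queries.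
\<close>

section \<open>Distances in the cycle\<close>

text \<open>For \<open>u, v < n\<close> this is \<open>(v + n - u) mod n\<close>; the case split
  keeps later goals within linear arithmetic.\<close>

definition clockwise_dist :: "nat \<Rightarrow> nat \<Rightarrow> nat \<Rightarrow> nat" where
  "clockwise_dist n u v = (if u \<le> v then v - u else v + n - u)"

definition cyc_dist :: "nat \<Rightarrow> nat \<Rightarrow> nat \<Rightarrow> nat" where
  "cyc_dist n u v = min (clockwise_dist n u v) (n - clockwise_dist n u v)"

definition cyc_pred :: "nat \<Rightarrow> nat \<Rightarrow> nat" where
  "cyc_pred n v = (if v = 0 then n - 1 else v - 1)"

lemma Suc_mod_if: "v < n \<Longrightarrow> Suc v mod n = (if Suc v = n then 0 else Suc v)"
  by (simp add: mod_Suc)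

lemma clockwise_dist_self [simp]: "clockwise_dist n v v = 0"
  by (simp add: clockwise_dist_def)

lemma clockwise_dist_less: "u < n \<Longrightarrow> v < n \<Longrightarrow> clockwise_dist n u v < n"
  by (auto simp: clockwise_dist_def)

lemma clockwise_dist_eq_0_iff: "u < n \<Longrightarrow> clockwise_dist n u v = 0 \<longleftrightarrow> u = v"
  by (auto simp: clockwise_dist_def)

lemma clockwise_dist_Suc:
  assumes "v < n" "x < n" "v \<noteq> x"
  shows "clockwise_dist n v x = Suc (clockwise_dist n (Suc v mod n) x)"
  using assms by (auto simp: Suc_mod_if clockwise_dist_def)

lemma clockwise_dist_Suc_self: "v < n \<Longrightarrow> clockwise_dist n (Suc v mod n) v = n - 1"
  by (auto simp: Suc_mod_if clockwise_dist_def)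

lemma cyc_pred_less: "v < n \<Longrightarrow> cyc_pred n v < n"
  by (auto simp: cyc_pred_def)

lemma Suc_cyc_pred_mod: "v < n \<Longrightarrow> Suc (cyc_pred n v) mod n = v"
  by (auto simp: cyc_pred_def)

lemma cyc_dist_self [simp]: "cyc_dist n v v = 0"
  by (simp add: cyc_dist_def)

lemma cyc_dist_eq_0_iff: "u < n \<Longrightarrow> v < n \<Longrightarrow> cyc_dist n u v = 0 \<longleftrightarrow> u = v"
  using clockwise_dist_less[of u n v] clockwise_dist_eq_0_iff[of u n v]
  by (auto simp: cyc_dist_def min_def)

text \<open>A clockwise step lowers the clockwise distance to \<open>x\<close> by one, except at
  \<open>x\<close> itself, where it jumps from 0 to \<open>n - 1\<close>; the minimum with the
  complementary arc turns that jump into a change of at most 1.\<close>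

lemma cyc_dist_adjacent_le:
  assumes "u < n" "v < n" "x < n" "v = Suc u mod n \<or> u = Suc v mod n"
  shows "cyc_dist n u x \<le> Suc (cyc_dist n v x)"
proof -
  \<comment> \<open>Both inequalities are shown for a clockwise step, so that \<open>w = u\<close>
    and \<open>w = v\<close> cover the two orientations of the edge.\<close>
  have "cyc_dist n w x \<le> Suc (cyc_dist n (Suc w mod n) x) \<and>
        cyc_dist n (Suc w mod n) x \<le> Suc (cyc_dist n w x)" if "w < n" for w
  proof (cases "w = x")
    case True
    then show ?thesis
      using that by (simp add: cyc_dist_def clockwise_dist_Suc_self)
  next
    case False
    then show ?thesis
      using clockwise_dist_Suc[of w n x] that assms(3) by (simp add: cyc_dist_def) linarith
  qed
  with assms show ?thesis by blast
qed

text \<open>A clockwise arc of at most half the cycle attains the minimum, and so does the arc left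
  after one step. Equality, the antipodal case, is included.\<close>

lemma cyc_dist_Suc:
  assumes "v < n" "x < n" "v \<noteq> x" "2 * clockwise_dist n v x \<le> n"
  shows "cyc_dist n v x = Suc (cyc_dist n (Suc v mod n) x)"
  using clockwise_dist_Suc[OF assms(1-3)] assms(4) by (simp add: cyc_dist_def)

lemma cyc_dist_cyc_pred:
  assumes "v < n" "x < n" "v \<noteq> x" "n \<le> 2 * clockwise_dist n v x"
  shows "cyc_dist n v x = Suc (cyc_dist n (cyc_pred n v) x)"
\<comment> \<open>Stepping back lengthens the clockwise arc by one unless it arrives at
  \<open>x\<close>, where that arc has length 0 instead of \<open>n\<close>.\<close>
proof (cases "cyc_pred n v = x")
  case True
  then have "v = Suc x mod n"
    using Suc_cyc_pred_mod[OF assms(1)] by simp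
  with True assms show ?thesis
    by (simp add: cyc_dist_def clockwise_dist_Suc_self)
next
  case False
  then have "clockwise_dist n (cyc_pred n v) x = Suc (clockwise_dist n v x)"
    using clockwise_dist_Suc[of "cyc_pred n v" n x] assms
    by (simp add: cyc_pred_less Suc_cyc_pred_mod)
  with assms clockwise_dist_less[of v n x] show ?thesis
    by (simp add: cyc_dist_def)
qed

lemma cyc_dist_step:
  assumes "v < n" "x < n" "v \<noteq> x"
  shows "cyc_dist n v x = Suc (cyc_dist n (Suc v mod n) x) \<or>
         cyc_dist n v x = Suc (cyc_dist n (cyc_pred n v) x)"
  using cyc_dist_Suc[OF assms] cyc_dist_cyc_pred[OF assms] by linarith

section \<open>Cycle distance as graph distance\<close>

lemma Suc_mod_in_nbrs: "v < n \<Longrightarrow> Suc v mod n \<in> nbrs (cycle_graph n) v"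
  by (auto simp: nbrs_def cycle_graph_def)

lemma cyc_pred_in_nbrs: "v < n \<Longrightarrow> cyc_pred n v \<in> nbrs (cycle_graph n) v"
  by (auto simp: nbrs_def cycle_graph_def cyc_pred_def)

lemma nbrs_cycle_graph_less: "u \<in> nbrs (cycle_graph n) v \<Longrightarrow> u < n"
  by (simp add: nbrs_def cycle_graph_def)

text \<open>Along any walk \<open>cyc_dist\<close> to the end vertex drops by at most 1 per arc,
  which bounds every cost from below; always moving to a neighbour that is one step closer gives a
  walk attaining the bound.\<close>

lemma graph_dist_cycle_graph:
  assumes "n \<ge> 3" "u < n" "v < n"
  shows "graph_dist (cycle_graph n) (\<lambda>_. 1) u v = ereal (real (cyc_dist n u v))"
proof -
  interpret pair_graph "cycle_graph n"
    using assms(1) by (rule pair_graph_cycle_graph)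
  have lower: "real (cyc_dist n u v) \<le> awalk_cost (\<lambda>_. 1) p" if "awalk u p v" for p
    using that assms(2)
  proof (induction p arbitrary: u)
    case Nil
    then show ?case by (simp add: awalk_Nil_iff)
  next
    case (Cons e p)
    then have e: "e \<in> parcs (cycle_graph n)" "u = fst e" and w: "awalk (snd e) p v"
      by (auto simp: awalk_Cons_iff)
    then have "snd e < n" "snd e = Suc u mod n \<or> u = Suc (snd e) mod n"
      by (auto simp: cycle_graph_def)
    with Cons.IH[OF w] cyc_dist_adjacent_le[of u n "snd e" v] Cons.prems assms(3)
    show ?case by simp
  qed
  have upper: "\<exists>p. awalk u p v \<and> awalk_cost (\<lambda>_. 1) p = real (cyc_dist n u v)"
    using assms(2)
  proof (induction "cyc_dist n u v" arbitrary: u)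
    case 0
    then have "u = v"
      using assms(3) by (simp add: cyc_dist_eq_0_iff)
    moreover have "u \<in> pverts (cycle_graph n)"
      using 0 by (simp add: cycle_graph_def)
    ultimately have "awalk u [] v"
      by (simp add: awalk_Nil_iff)
    then show ?case
      using 0 by (intro exI[of _ "[]"]) simp
  next
    case (Suc k)
    then have "u \<noteq> v" by auto
    with cyc_dist_step[of u n v] Suc.hyps(2) Suc.prems assms(3)
    obtain u' where u': "u' \<in> nbrs (cycle_graph n) u" "k = cyc_dist n u' v"
      using Suc_mod_in_nbrs[of u n] cyc_pred_in_nbrs[of u n] by (metis old.nat.inject)
    then obtain p where "awalk u' p v" "awalk_cost (\<lambda>_. 1) p = real k"
      using Suc.hyps(1) nbrs_cycle_graph_less by metis
    then have "awalk u ((u, u') # p) v"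
      "awalk_cost (\<lambda>_. 1) ((u, u') # p) = real (cyc_dist n u v)"
      using u'(1) Suc.hyps(2) by (auto simp: awalk_Cons_iff nbrs_def simp flip: Suc.hyps(2))
    then show ?case by blast
  qed
  then obtain p where p: "awalk u p v" "awalk_cost (\<lambda>_. 1) p = real (cyc_dist n u v)"
    by blast
  show ?thesis
  proof (rule antisym)
    show "\<mu> (\<lambda>_. 1) u v \<le> ereal (real (cyc_dist n u v))"
      using min_cost_le_walk_cost[OF p(1), of "\<lambda>_. 1"] p(2) by simp
    show "ereal (real (cyc_dist n u v)) \<le> \<mu> (\<lambda>_. 1) u v"
      unfolding \<mu>_def by (intro INF_greatest) (use lower in simp)
  qed
qed

lemma via_nbr_cycle_graph_iff:
  assumes "n \<ge> 3" "v < n" "u < n"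
  shows "x \<in> via_nbr (cycle_graph n) (\<lambda>_. 1) v u \<longleftrightarrow>
         x < n \<and> cyc_dist n v x = Suc (cyc_dist n u x)"
proof (cases "x < n")
  case True
  have "ereal (real (cyc_dist n v x)) = ereal 1 + ereal (real (cyc_dist n u x)) \<longleftrightarrow>
        cyc_dist n v x = Suc (cyc_dist n u x)"
    by simp linarith
  with True assms show ?thesis
    by (simp add: via_nbr_def graph_dist_cycle_graph) (simp add: cycle_graph_def)
qed (simp add: via_nbr_def cycle_graph_def)

section \<open>The adversary\<close>

text \<open>For odd \<open>n\<close> this is not an involution, so a vertex can lie in two different
  pairs.\<close>

definition antip :: "nat \<Rightarrow> nat \<Rightarrow> nat" where
  "antip n t = (t + n div 2) mod n"

lemma antip_if: "t < n \<Longrightarrow> antip n t = (if t + n div 2 < n then t + n div 2 else t + n div 2 - n)"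
  by (simp add: antip_def le_mod_geq)

lemma antip_less: "t < n \<Longrightarrow> antip n t < n"
  by (simp add: antip_def)

lemma antip_neq: "n \<ge> 3 \<Longrightarrow> t < n \<Longrightarrow> antip n t \<noteq> t"
  by (simp add: antip_if) linarith

lemma inj_on_antip: "inj_on (antip n) {..<n}"
proof (rule inj_onI)
  fix s t
  assume "s \<in> {..<n}" "t \<in> {..<n}" "antip n s = antip n t"
  then have "[s + n div 2 = t + n div 2] (mod n)" "s < n" "t < n"
    by (simp_all add: antip_def cong_def)
  then show "s = t"
    by (simp add: cong_add_rcancel_nat cong_less_modulus_unique_nat)
qed

text \<open>The pair cuts the cycle into arcs of lengths \<open>n div 2\<close> and
  \<open>n - n div 2\<close>. From a vertex strictly inside either arc, the first pair member met
  clockwise is at most \<open>n div 2\<close> steps away, so the clockwise step lies on a shortest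
  path to it.\<close>

lemma clockwise_towards_antip_pair:
  assumes "n \<ge> 3" "v < n" "t < n" "v \<noteq> t" "v \<noteq> antip n t"
  shows "cyc_dist n v t = Suc (cyc_dist n (Suc v mod n) t) \<or>
         cyc_dist n v (antip n t) = Suc (cyc_dist n (Suc v mod n) (antip n t))"
proof -
  define k where "k = n div 2"
  have k: "2 * k \<le> n" "n \<le> 2 * k + 1"
    by (simp_all add: k_def)
  have "2 * clockwise_dist n v t \<le> n \<or> 2 * clockwise_dist n v (antip n t) \<le> n"
  proof (cases "t + k < n")
    case True
    then have a: "antip n t = t + k"
      using assms(3) by (simp add: antip_if k_def)
    \<comment> \<open>The cases tell which member of the pair is met first clockwise, and whether
      the way there passes 0.\<close>
    consider "v \<le> t" | "t < v" "v \<le> t + k" | "t + k < v"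
      by linarith
    then show ?thesis
    proof cases
      case 1
      then have "2 * clockwise_dist n v t \<le> n"
        using k True by (simp add: clockwise_dist_def)
      then show ?thesis ..
    next
      case 2
      then have "2 * clockwise_dist n v (t + k) \<le> n"
        using k True by (simp add: clockwise_dist_def)
      then show ?thesis unfolding a ..
    next
      \<comment> \<open>The arc from \<open>t + k\<close> round to \<open>t\<close> may have
        \<open>k + 1\<close> edges; as \<open>v\<close> lies strictly beyond \<open>t + k\<close>,
        at most \<open>n - k - 1 \<le> k\<close> of them remain.\<close>
      case 3
      then have "2 * clockwise_dist n v t \<le> n"
        using k True assms(2) by (simp add: clockwise_dist_def)
      then show ?thesis ..
    qed
  next
    case False
    then have a: "antip n t = t + k - n"
      using assms(3) by (simp add: antip_if k_def)
    consider "v \<le> t + k - n" | "t + k - n < v" "v \<le> t" | "t < v" "t + k - n < v"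
      using assms(3) k by linarith
    then show ?thesis
    proof cases
      case 1
      then have "2 * clockwise_dist n v (t + k - n) \<le> n"
        using k False assms(2,3) by (simp add: clockwise_dist_def)
      then show ?thesis unfolding a ..
    next
      case 2
      then have "2 * clockwise_dist n v t \<le> n"
        using k False assms(2,3) by (simp add: clockwise_dist_def)
      then show ?thesis ..
    next
      case 3
      then have "2 * clockwise_dist n v (t + k - n) \<le> n"
        using k False assms(2,3) by (simp add: clockwise_dist_def)
      then show ?thesis unfolding a ..
    qed
  qed
  with assms show ?thesis
    using cyc_dist_Suc[of v n t] cyc_dist_Suc[of v n "antip n t"] by (auto simp: antip_less)
qed

text \<open>The clockwise neighbour is preferred also when both neighbours are correct.\<close>

definition clockwise_ties :: "nat \<Rightarrow> nat tie_breaking" where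
  "clockwise_ties n h v t =
     (if cyc_dist n v t = Suc (cyc_dist n (Suc v mod n) t) then Suc v mod n else cyc_pred n v)"

text \<open>When the clockwise neighbour is not closer to the target, \<open>cyc_dist_step\<close>
  makes the other neighbour correct.\<close>

lemma admissible_clockwise_ties:
  assumes "n \<ge> 3" "t1 < n" "t2 < n" "t1 \<noteq> t2"
  shows "admissible (cycle_graph n) (\<lambda>_. 1) t1 t2 (clockwise_ties n)"
proof -
  have "clockwise_ties n h v t \<in> nbrs (cycle_graph n) v \<and>
        t \<in> via_nbr (cycle_graph n) (\<lambda>_. 1) v (clockwise_ties n h v t)"
    if "v < n" "t < n" "v \<noteq> t" for h v t
  proof -
    have nbr: "clockwise_ties n h v t \<in> nbrs (cycle_graph n) v"
      using that by (simp add: clockwise_ties_def Suc_mod_in_nbrs cyc_pred_in_nbrs)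
    moreover have "cyc_dist n v t = Suc (cyc_dist n (clockwise_ties n h v t) t)"
      using cyc_dist_step[OF that] by (auto simp: clockwise_ties_def)
    ultimately show ?thesis
      using that assms(1) by (simp add: via_nbr_cycle_graph_iff nbrs_cycle_graph_less)
  qed
  with assms show ?thesis
    by (auto simp: admissible_def) (auto simp: cycle_graph_def)
qed

lemma admissible_antip_pair:
  "n \<ge> 3 \<Longrightarrow> t < n \<Longrightarrow> admissible (cycle_graph n) (\<lambda>_. 1) t (antip n t) (clockwise_ties n)"
  by (metis admissible_clockwise_ties antip_less antip_neq)

section \<open>Histories in which every answer is clockwise\<close>

text \<open>The targets do not occur here: under these answers even an adaptive algorithm asks a
  sequence of queries fixed in advance.\<close>

primrec clockwise_history :: "nat \<Rightarrow> nat algorithm \<Rightarrow> nat \<Rightarrow> nat history" where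
  "clockwise_history n A 0 = []"
| "clockwise_history n A (Suc m) = (let h = clockwise_history n A m
     in h @ [(A h, Towards (Suc (A h) mod n))])"

lemma length_clockwise_history [simp]: "length (clockwise_history n A m) = m"
  by (induction m) (simp_all add: Let_def)

lemma clockwise_history_mono:
  "m \<le> m' \<Longrightarrow> set (clockwise_history n A m) \<subseteq> set (clockwise_history n A m')"
  by (rule lift_Suc_mono_le) (auto simp: Let_def)

lemma set_query_pmf_half:
  "set_pmf (query_pmf (1/2) t1 t2 c h v) =
     {if v = t1 then Is_Target else Towards (c h v t1),
      if v = t2 then Is_Target else Towards (c h v t2)}"
  by (auto simp: query_pmf_def UNIV_bool)

text \<open>At each unqueried pair the clockwise answer is correct for one member, and the coin
  directs to that member with positive probability.\<close>

lemma clockwise_history_possible: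
  assumes "n \<ge> 3" "\<And>h. A h < n" "t < n"
    and "t \<notin> fst ` set (clockwise_history n A m)"
    and "antip n t \<notin> fst ` set (clockwise_history n A m)"
  shows "clockwise_history n A m
           \<in> set_pmf (history_pmf (1/2) t (antip n t) (clockwise_ties n) A m)"
  using assms(4,5)
proof (induction m)
  case (Suc m)
  define h where "h = clockwise_history n A m"
  have "A h \<noteq> t" "A h \<noteq> antip n t"
    using Suc.prems by (auto simp: Let_def h_def)
  then have "Towards (Suc (A h) mod n)
               \<in> set_pmf (query_pmf (1/2) t (antip n t) (clockwise_ties n) h (A h))"
    using clockwise_towards_antip_pair[of n "A h" t] assms(1-3)
    by (auto simp: set_query_pmf_half clockwise_ties_def)
  moreover have "h \<in> set_pmf (history_pmf (1/2) t (antip n t) (clockwise_ties n) A m)"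
    using Suc by (auto simp: Let_def h_def)
  ultimately show ?case
    by (auto simp: Let_def simp flip: h_def)
qed simp

section \<open>Counting the consistent pairs\<close>

lemma exists_consistent_pair_avoiding:
  assumes "2 * m + 2 < n"
  obtains t where "t < n" "t \<notin> fst ` set (clockwise_history n A m)"
    "antip n t \<notin> fst ` set (clockwise_history n A m)" "x \<noteq> t" "x \<noteq> antip n t"
proof -
  \<comment> \<open>\<open>Q\<close> holds the at most \<open>m + 1\<close> forbidden vertices. A
    value \<open>t\<close> is bad if it lies in \<open>Q\<close> or, by \<open>B\<close>, if its
    partner does; injectivity of \<open>antip\<close> gives at most \<open>2 * m + 2 < n\<close> bad
    values.\<close>
  define Q where "Q = insert x (fst ` set (clockwise_history n A m))"
  define B where "B = (antip n -` Q) \<inter> {..<n}"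
  have fin: "finite Q" by (simp add: Q_def)
  have "card (fst ` set (clockwise_history n A m)) \<le> m"
    by (metis card_image_le card_length finite_set le_trans length_clockwise_history)
  then have Q: "card Q \<le> Suc m"
    unfolding Q_def by (simp add: card_insert_if)
  have "card B \<le> card Q"
    using fin by (intro card_inj_on_le[OF inj_on_subset[OF inj_on_antip]]) (auto simp: B_def)
  with Q have "card (Q \<union> B) < card {..<n}"
    using assms card_Un_le[of Q B] by simp
  then have "\<not> {..<n} \<subseteq> Q \<union> B"
    using fin by (metis B_def card_mono finite_Int finite_UnI finite_lessThan not_le)
  then obtain t where "t < n" "t \<notin> Q" "antip n t \<notin> Q"
    by (auto simp: B_def)
  then show thesis
    using that[of t] by (auto simp: Q_def)
qed

text \<open>Each candidate vertex \<open>x\<close> is refuted by a pair of its own, chosen after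
  \<open>x\<close>, that avoids \<open>x\<close> and can produce the same history.\<close>

lemma clockwise_history_not_detected:
  assumes "n \<ge> 3" "\<And>h. A h < n" "2 * m + 2 < n"
  shows "\<not> detected (cycle_graph n) (\<lambda>_. 1) (1/2) A (clockwise_history n A m)"
proof
  assume "detected (cycle_graph n) (\<lambda>_. 1) (1/2) A (clockwise_history n A m)"
  then obtain x where x: "\<forall>t1 t2 c. admissible (cycle_graph n) (\<lambda>_. 1) t1 t2 c \<and>
      clockwise_history n A m \<in> set_pmf (history_pmf (1/2) t1 t2 c A m) \<longrightarrow> x \<in> {t1, t2}"
    unfolding detected_def length_clockwise_history ..
  obtain t where t: "t < n" "t \<notin> fst ` set (clockwise_history n A m)"
    "antip n t \<notin> fst ` set (clockwise_history n A m)" "x \<noteq> t" "x \<noteq> antip n t"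
    using exists_consistent_pair_avoiding[OF assms(3)] .
  have "admissible (cycle_graph n) (\<lambda>_. 1) t (antip n t) (clockwise_ties n)"
    using assms(1) t(1) by (rule admissible_antip_pair)
  moreover have "clockwise_history n A m
      \<in> set_pmf (history_pmf (1/2) t (antip n t) (clockwise_ties n) A m)"
    using assms(1,2) t(1-3) by (rule clockwise_history_possible)
  ultimately have "x \<in> {t, antip n t}"
    using x by blast
  with t show False by simp
qed

theorem corollary1:
  fixes n :: nat and A :: "nat algorithm"
  assumes "n \<ge> 3"
    and "\<And>h. A h \<in> pverts (cycle_graph n)"
  shows "\<exists>t1 t2 c. admissible (cycle_graph n) (\<lambda>_. 1) t1 t2 c \<and>
     (\<forall>m. real m < real n / 2 - 1 \<longrightarrow>
        measure_pmf.prob (history_pmf (1/2) t1 t2 c A m)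
          {h. \<not> detected (cycle_graph n) (\<lambda>_. 1) (1/2) A h} > 0)"
proof -
  have A: "A h < n" for h
    using assms(2)[of h] by (simp add: cycle_graph_def)
  \<comment> \<open>\<open>M\<close> is the largest \<open>m\<close> with
    \<open>2 * m + 2 < n\<close>. The targets must be fixed before \<open>m\<close>, so a pair is
    chosen for length \<open>M\<close>; shorter histories query only vertices that the longest one
    queries.\<close>
  define M where "M = (n - 3) div 2"
  have M: "2 * M + 2 < n"
    using assms(1) by (simp add: M_def)
  obtain t where t: "t < n" "t \<notin> fst ` set (clockwise_history n A M)"
    "antip n t \<notin> fst ` set (clockwise_history n A M)"
    using exists_consistent_pair_avoiding[OF M] by metis
  have "measure_pmf.prob (history_pmf (1/2) t (antip n t) (clockwise_ties n) A m)
          {h. \<not> detected (cycle_graph n) (\<lambda>_. 1) (1/2) A h} > 0"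
    if "real m < real n / 2 - 1" for m
  proof -
    have m: "2 * m + 2 < n" using that by linarith
    then have "m \<le> M" by (simp add: M_def)
    then have sub: "fst ` set (clockwise_history n A m) \<subseteq> fst ` set (clockwise_history n A M)"
      by (intro image_mono clockwise_history_mono)
    \<comment> \<open>The fixed pair makes the history possible; that it detects nothing comes from
      the other pairs consistent with it.\<close>
    have "clockwise_history n A m
        \<in> set_pmf (history_pmf (1/2) t (antip n t) (clockwise_ties n) A m)"
      by (rule clockwise_history_possible) (use sub assms(1) A t in auto)
    moreover have "\<not> detected (cycle_graph n) (\<lambda>_. 1) (1/2) A (clockwise_history n A m)"
      using assms(1) A m by (rule clockwise_history_not_detected)
    ultimately show ?thesis
      by (intro measure_pmf_posI[of "clockwise_history n A m"]) auto
  qed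
  moreover have "admissible (cycle_graph n) (\<lambda>_. 1) t (antip n t) (clockwise_ties n)"
    using assms(1) t(1) by (rule admissible_antip_pair)
  ultimately show ?thesis
    by (intro exI conjI allI impI)
qed

end
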